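(* For every $f, g \in \mathcal{S}$ there exists $h \in \mathcal{S}$ such that $\mathscr{U}_{f,g} = A^{[h]}$. Moreover, $$\frac{h''}{h'} = \max\left(\frac{f''}{f'}, \frac{g''}{g'}\right)$$ (pointwise on $I$).
   Context: $I \subset \mathbb{R}$ is an interval. $\mathcal{CM}$ denotes the family of all continuous, strictly monotone functions $f \colon I \to \mathbb{R}$. $\mathcal{S}$ denotes the family of all $\mathcal{C}^2$ functions $f \colon I \to \mathbb{R}$ whose first derivative vanishes nowhere on $I$ (so $\mathcal{S} \subset \mathcal{CM}$). For $f \in \mathcal{CM}$ the quasi-arithmetic mean $A^{[f]} \colon \bigcup_{n=1}^\infty I^n \to I$ is defined by $A^{[f]}(v) := f^{-1}\left(\frac{f(v_1)+\cdots+f(v_n)}{n}\right)$ for $n \in \mathbb{N}$, $v \in I^n$. For $f, g \in \mathcal{CM}$ write $f \prec g$ if $A^{[f]}(v) \le A^{[g]}(v)$ for all $v \in \bigcup_{n \in \mathbb{N}} I^n$. For $f \in \mathcal{CM}$ put $U_f := \{ s \in \mathcal{CM} : f \prec s\}$. For $f, g \in \mathcal{CM}$ the function $\mathscr{U}_{f,g} \colon \bigcup_{n=1}^\infty I^n \to I$ is defined by $\mathscr{U}_{f,g}(v) := \inf\{A^{[s]}(v) : s \in U_f \cap U_g\}$ if $U_f \cap U_g \neq \emptyset$, and $\mathscr{U}_{f,g}(v) := \max(v)$ otherwise. *)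

theory Defs
  imports "HOL-Analysis.Analysis"
begin

text \<open>
  A function \<open>I \<rightarrow> \<real>\<close> is represented by a total function \<^typ>\<open>real \<Rightarrow> real\<close> of which only the
  values on \<open>I\<close> matter. A vector in the union of the powers \<open>I\<^sup>n\<close> with \<open>n \<ge> 1\<close> is represented
  by a nonempty list over \<open>I\<close>.
\<close>

definition vectors :: "real set \<Rightarrow> real list set" where
  "vectors I = {v. v \<noteq> [] \<and> set v \<subseteq> I}"

definition CM :: "real set \<Rightarrow> (real \<Rightarrow> real) set" where
  "CM I = {f. continuous_on I f \<and> (strict_mono_on I f \<or> strict_antimono_on I f)}"

text \<open>
  The derivative is taken relative to \<open>I\<close>, hence it is one-sided at an endpoint belonging to \<open>I\<close>.
\<close>

definition D :: "real set \<Rightarrow> (real \<Rightarrow> real) \<Rightarrow> real \<Rightarrow> real" where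
  "D I f x = vector_derivative f (at x within I)"

definition C2_on :: "real set \<Rightarrow> (real \<Rightarrow> real) \<Rightarrow> bool" where
  "C2_on I f \<longleftrightarrow>
     f differentiable_on I \<and> D I f differentiable_on I \<and> continuous_on I (D I (D I f))"

definition SM :: "real set \<Rightarrow> (real \<Rightarrow> real) set" where
  "SM I = {f. C2_on I f \<and> (\<forall>x\<in>I. D I f x \<noteq> 0)}"

definition qa_mean :: "real set \<Rightarrow> (real \<Rightarrow> real) \<Rightarrow> real list \<Rightarrow> real" where
  "qa_mean I f v = the_inv_into I f (sum_list (map f v) / real (length v))"

definition qa_le :: "real set \<Rightarrow> (real \<Rightarrow> real) \<Rightarrow> (real \<Rightarrow> real) \<Rightarrow> bool" where
  "qa_le I f g \<longleftrightarrow> (\<forall>v\<in>vectors I. qa_mean I f v \<le> qa_mean I g v)"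

definition upper :: "real set \<Rightarrow> (real \<Rightarrow> real) \<Rightarrow> (real \<Rightarrow> real) set" where
  "upper I f = {s \<in> CM I. qa_le I f s}"

definition upper_mean :: "real set \<Rightarrow> (real \<Rightarrow> real) \<Rightarrow> (real \<Rightarrow> real) \<Rightarrow> real list \<Rightarrow> real" where
  "upper_mean I f g v =
     (if upper I f \<inter> upper I g \<noteq> {} then INF s\<in>upper I f \<inter> upper I g. qa_mean I s v
      else Max (set v))"

end

theory Submission
  imports Defs
begin

text \<open>
  Write \<open>r\<^sub>k = k'' / k'\<close> for the ratio of a generator \<open>k\<close>. The ratio measures the curvature of
  \<open>k\<close> relative to its slope and is unchanged by affine reparametrisation of the values, just as the
  mean is. On an interval with more than one point, integrating \<open>max r\<^sub>f r\<^sub>g\<close>, exponentiating and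
  integrating again gives an increasing generator \<open>h\<close> with \<open>r\<^sub>h = max r\<^sub>f r\<^sub>g\<close>. It remains to
  see that \<open>h\<close> is the least upper bound of \<open>f\<close> and \<open>g\<close> among all continuous strictly monotone
  generators, for then the infimum is attained at \<open>h\<close>.

  That \<open>h\<close> is an upper bound is the classical fact that \<open>r\<^sub>f \<le> r\<^sub>h\<close> makes \<open>h \<circ> f\<^sup>-\<^sup>1\<close>
  convex. That it is the least one is more delicate, because a competitor \<open>s\<close> is only continuous,
  and because the larger one of \<open>r\<^sub>f\<close>, \<open>r\<^sub>g\<close> may change infinitely often. Both facts are instances
  of one comparison principle, \<open>qa_le_if_curvature_dominated\<close>: the mean of \<open>k\<close> is below that of
  \<open>s\<close> as soon as every interior point \<open>x\<close> admits a smooth \<open>c\<close>, which may depend on \<open>x\<close>, whose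
  mean is below that of \<open>s\<close> and which satisfies \<open>r\<^sub>k x \<le> r\<^sub>c x\<close> at this one point. The upper
  bound uses \<open>c = h = s\<close>; minimality uses \<open>c = f\<close> or \<open>c = g\<close>, whichever has the larger ratio
  at \<open>x\<close>.

  The comparison principle is proved as for viscosity solutions, with all derivatives falling on
  test functions. Let \<open>s\<close> be increasing. If \<open>s \<circ> k\<^sup>-\<^sup>1\<close> is not convex, its graph exceeds a
  chord, and a slightly concave parabola over that chord can be raised until it touches the graph from
  above, at an interior point \<open>x0\<close> (\<open>convex_through_generator\<close>). In the original variable this is a
  test function \<open>T = \<alpha> + \<beta> k - \<epsilon> k\<^sup>2\<close> above \<open>s\<close>, with equality at \<open>x0\<close>. Since \<open>s\<close>
  increases, \<open>T' x0 \<ge> 0\<close>. Choose \<open>l\<close> such that \<open>T - l c\<close> is stationary at \<open>x0\<close>; its second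
  derivative there is \<open>T' (r\<^sub>k - r\<^sub>c) - 2 \<epsilon> k'\<^sup>2 < 0\<close>. So \<open>T - l c\<close>, and with it \<open>s - l c\<close>, has
  a strict local maximum at \<open>x0\<close>. But this is impossible when the mean of \<open>c\<close> is below that of
  \<open>s\<close>: averaging over two points whose \<open>c\<close>-mean is \<open>x0\<close> does not lower \<open>s - l c\<close>
  (\<open>no_strict_local_max\<close>).
\<close>

section \<open>Generators on an interval\<close>

lemma SM_derivatives:
  assumes "f \<in> SM I" "x \<in> I"
  shows "(f has_real_derivative D I f x) (at x within I)"
    and "(D I f has_real_derivative D I (D I f) x) (at x within I)"
    and "D I f x \<noteq> 0"
  using assms unfolding SM_def C2_on_def differentiable_on_def D_def
  by (auto simp: has_real_derivative_iff_has_vector_derivative vector_derivative_works)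

lemma SM_derivatives_interior:
  assumes "f \<in> SM I" "x \<in> interior I"
  shows "(f has_real_derivative D I f x) (at x)"
    and "(D I f has_real_derivative D I (D I f) x) (at x)"
    and "D I f x \<noteq> 0"
  using SM_derivatives[OF assms(1) subsetD[OF interior_subset assms(2)]]
  by (simp_all add: at_within_interior[OF assms(2)])

lemma SM_continuous: "f \<in> SM I \<Longrightarrow> continuous_on I f"
  using SM_derivatives(1) by (rule DERIV_continuous_on)

lemma SM_inj_on:
  assumes "is_interval I" "f \<in> SM I"
  shows "inj_on f I"
proof (rule linorder_inj_onI)
  fix a b assume ab: "a < b" "a \<in> I" "b \<in> I"
  have sub: "{a..b} \<subseteq> I"
    using ab assms(1) by (meson atLeastAtMost_iff mem_is_interval_1_I subsetI)
  have int: "x \<in> interior I" if "a < x" "x < b" for x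
    using that sub by (metis greaterThanLessThan_iff interior_atLeastAtMost_real interior_mono subsetD)
  show "f a \<noteq> f b"
  proof
    assume "f a = f b"
    moreover have "continuous_on {a..b} f"
      using SM_continuous[OF assms(2)] sub continuous_on_subset by blast
    ultimately obtain z where z: "a < z" "z < b" "DERIV f z :> 0"
      using Rolle[of a b f] ab SM_derivatives_interior(1)[OF assms(2) int]
      by (metis real_differentiable_def)
    show False
      using DERIV_unique[OF z(3) SM_derivatives_interior(1)[OF assms(2) int[OF z(1,2)]]]
        SM_derivatives_interior(3)[OF assms(2) int[OF z(1,2)]] by simp
  qed
qed auto

lemma CM_continuous: "s \<in> CM I \<Longrightarrow> continuous_on I s"
  by (simp add: CM_def)

lemma CM_inj_on: "s \<in> CM I \<Longrightarrow> inj_on s I"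
  by (rule linorder_inj_onI) (fastforce simp: CM_def monotone_on_def)+

lemma mean_eq_weighted_sum:
  "sum_list (map s v) / real (length v) = (\<Sum>i<length v. (1 / real (length v)) *\<^sub>R s (v ! i))"
  by (simp add: sum_list_sum_nth atLeast0LessThan sum_divide_distrib)

lemma convex_image_of_interval:
  fixes s :: "real \<Rightarrow> real"
  assumes "is_interval I" "continuous_on I s"
  shows "convex (s ` I)"
  using assms connected_continuous_image connected_convex_1 is_interval_connected_1 by blast

lemma
  assumes "is_interval I" "continuous_on I s" "inj_on s I" "v \<in> vectors I"
  shows qa_mean_in_interval: "qa_mean I s v \<in> I"
    and generator_qa_mean: "s (qa_mean I s v) = sum_list (map s v) / real (length v)"
proof -
  have v: "v \<noteq> []" "set v \<subseteq> I"
    using assms(4) by (auto simp: vectors_def)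
  have "(\<Sum>i<length v. (1 / real (length v)) *\<^sub>R s (v ! i)) \<in> s ` I"
  proof (rule convex_sum[OF _ convex_image_of_interval[OF assms(1,2)]])
    show "s (v ! i) \<in> s ` I" if "i \<in> {..<length v}" for i
      using that v(2) nth_mem by blast
  qed (use v in auto)
  then have mem: "sum_list (map s v) / real (length v) \<in> s ` I"
    by (simp add: mean_eq_weighted_sum)
  show "qa_mean I s v \<in> I"
    unfolding qa_mean_def using the_inv_into_into[OF assms(3) mem] by blast
  show "s (qa_mean I s v) = sum_list (map s v) / real (length v)"
    unfolding qa_mean_def by (rule f_the_inv_into_f[OF assms(3) mem])
qed

text \<open>
  Negating a generator does not change its mean, so decreasing generators reduce to increasing ones.
\<close>

lemma qa_mean_uminus: "qa_mean I (\<lambda>x. - s x) v = qa_mean I s v"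
proof -
  have "sum_list (map (\<lambda>x. - s x) v) = - sum_list (map s v)"
    by (induction v) auto
  moreover have "the_inv_into I (\<lambda>x. - s x) (- y) = the_inv_into I s y" for y
    unfolding the_inv_into_def neg_equal_iff_equal ..
  ultimately show ?thesis
    by (simp only: qa_mean_def minus_divide_left[symmetric])
qed

section \<open>Comparison of means\<close>

lemma strict_local_max_second_derivative:
  fixes G G' :: "real \<Rightarrow> real"
  assumes "a < x0" "x0 < b"
    and dG: "\<And>x. a < x \<Longrightarrow> x < b \<Longrightarrow> (G has_real_derivative G' x) (at x)"
    and "(G' has_real_derivative l) (at x0)" "G' x0 = 0" "l < 0"
  obtains d where "d > 0" "\<And>x. x \<noteq> x0 \<Longrightarrow> \<bar>x - x0\<bar> < d \<Longrightarrow> G x < G x0"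
proof -
  obtain d1 where d1: "d1 > 0" "\<And>h. 0 < h \<Longrightarrow> h < d1 \<Longrightarrow> G' (x0 + h) < 0"
    using DERIV_neg_dec_right[OF assms(4,6), unfolded assms(5)] by blast
  obtain d2 where d2: "d2 > 0" "\<And>h. 0 < h \<Longrightarrow> h < d2 \<Longrightarrow> 0 < G' (x0 - h)"
    using DERIV_neg_dec_left[OF assms(4,6), unfolded assms(5)] by blast
  define d where "d = Min {d1, d2, x0 - a, b - x0}"
  have d: "d > 0" "d \<le> d1" "d \<le> d2" "d \<le> x0 - a" "d \<le> b - x0"
    using assms(1,2) d1(1) d2(1) by (auto simp: d_def)
  have "G x < G x0" if x: "x \<noteq> x0" "\<bar>x - x0\<bar> < d" for x
  proof (cases "x0 < x")
    case True
    then obtain z where z: "x0 < z" "z < x" "G x - G x0 = (x - x0) * G' z"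
      using MVT2[of x0 x G G'] dG x d by fastforce
    have "G' z < 0"
      using d1(2)[of "z - x0"] z x d by auto
    then show ?thesis
      using z True mult_pos_neg[of "x - x0" "G' z"] by linarith
  next
    case False
    then have "x < x0" using x by simp
    then obtain z where z: "x < z" "z < x0" "G x0 - G x = (x0 - x) * G' z"
      using MVT2[of x x0 G G'] dG x d by fastforce
    have "G' z > 0"
      using d2(2)[of "x0 - z"] z x d by auto
    then show ?thesis
      using z \<open>x < x0\<close> mult_pos_pos[of "x0 - x" "G' z"] by linarith
  qed
  with that d(1) show thesis by blast
qed

text \<open>
  Two-element vectors suffice. If \<open>c p\<close> and \<open>c q\<close> lie
  symmetrically about \<open>c x0\<close>, then \<open>x0\<close> is the \<open>c\<close>-mean of \<open>p\<close> and \<open>q\<close>, hence at most their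
  \<open>s\<close>-mean. So \<open>s x0\<close> is at most the average of \<open>s p\<close> and \<open>s q\<close>, while \<open>c x0\<close> equals the
  average of \<open>c p\<close> and \<open>c q\<close>; one of the two points must do at least as well as \<open>x0\<close>.
\<close>

lemma no_strict_local_max:
  assumes I: "is_interval I" and c: "c \<in> SM I" and s: "s \<in> CM I" "strict_mono_on I s"
    and le: "qa_le I c s"
    and x0: "x0 \<in> interior I" and "d > 0"
  shows "\<exists>x\<in>I. x \<noteq> x0 \<and> \<bar>x - x0\<bar> < d \<and> s x - l * c x \<ge> s x0 - l * c x0"
proof -
  obtain e where e: "e > 0" "cball x0 e \<subseteq> I"
    using x0 by (meson mem_interior_cball)
  define r where "r = min e (d / 2)"
  have r: "r > 0" "r < d" and "r \<le> e"
    using e \<open>d > 0\<close> by (auto simp: r_def)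
  then have sub: "{x0 - r..x0 + r} \<subseteq> I"
    using e(2) by (force simp: cball_eq_atLeastAtMost)
  have mem: "x0 - r \<in> I" "x0 + r \<in> I" "x0 \<in> I"
    using r sub by auto
  have cc: "continuous_on I c" and ci: "inj_on c I"
    using SM_continuous[OF c] SM_inj_on[OF I c] by auto
  \<comment> \<open>The values of \<open>c\<close> at the two ends enclose \<open>c x0\<close>, in an order that depends on whether
      \<open>c\<close> increases or decreases.\<close>
  have mono: "(c (x0 - r) < c x0 \<and> c x0 < c (x0 + r)) \<or> (c (x0 + r) < c x0 \<and> c x0 < c (x0 - r))"
    by (rule continuous_inj_imp_mono)
       (use r sub cc ci in \<open>auto intro: continuous_on_subset inj_on_subset\<close>)
  define \<delta> where "\<delta> = min \<bar>c (x0 + r) - c x0\<bar> \<bar>c (x0 - r) - c x0\<bar>"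
  have "\<delta> > 0" using mono by (auto simp: \<delta>_def)
  have cseg: "continuous_on (closed_segment (x0 - r) (x0 + r)) c"
    using r sub cc by (auto simp: closed_segment_eq_real_ivl intro: continuous_on_subset)
  have "c x0 + \<delta> \<in> closed_segment (c (x0 - r)) (c (x0 + r))"
       "c x0 - \<delta> \<in> closed_segment (c (x0 - r)) (c (x0 + r))"
    using mono by (auto simp: \<delta>_def closed_segment_eq_real_ivl)
  then obtain p q where p: "p \<in> {x0 - r..x0 + r}" "c p = c x0 + \<delta>"
    and q: "q \<in> {x0 - r..x0 + r}" "c q = c x0 - \<delta>"
    using IVT'_closed_segment_real[OF _ cseg] r(1)
    by (smt (verit) closed_segment_eq_real_ivl)
  have pq: "p \<in> I" "q \<in> I" "p \<noteq> x0" "q \<noteq> x0" "\<bar>p - x0\<bar> < d" "\<bar>q - x0\<bar> < d"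
    using p q r sub \<open>\<delta> > 0\<close> by auto
  have v: "[p, q] \<in> vectors I"
    using pq by (simp add: vectors_def)
  have "qa_mean I c [p, q] = x0"
    unfolding qa_mean_def using p q the_inv_into_f_f[OF ci mem(3)] by simp
  then have "x0 \<le> qa_mean I s [p, q]"
    using le v by (metis qa_le_def)
  then have "s x0 \<le> s (qa_mean I s [p, q])"
    using s(2) mem(3) qa_mean_in_interval[OF I CM_continuous[OF s(1)] CM_inj_on[OF s(1)] v]
    by (metis order_le_less strict_mono_onD)
  then have "2 * s x0 \<le> s p + s q"
    using generator_qa_mean[OF I CM_continuous[OF s(1)] CM_inj_on[OF s(1)] v] by simp
  moreover have "l * c p + l * c q = 2 * (l * c x0)"
    by (simp add: p q algebra_simps)
  ultimately have "s p - l * c p \<ge> s x0 - l * c x0 \<or> s q - l * c q \<ge> s x0 - l * c x0"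
    by linarith
  then show ?thesis using pq by blast
qed

text \<open>
  This is where the ratios enter: the concavity \<open>- \<epsilon>\<close> of the test function makes the second
  derivative of \<open>T - l c\<close> strictly negative although the ratios may be equal at \<open>x0\<close>. The
  inequality at the single point \<open>x0\<close> suffices, so \<open>c\<close> need not dominate \<open>k\<close> anywhere else.
\<close>

lemma no_touching_from_above:
  assumes I: "is_interval I" and k: "k \<in> SM I" and c: "c \<in> SM I"
    and s: "s \<in> CM I" "strict_mono_on I s" and le: "qa_le I c s"
    and x0: "x0 \<in> interior I"
    and ratio: "D I (D I k) x0 / D I k x0 \<le> D I (D I c) x0 / D I c x0"
    and "\<epsilon> > 0" "a < x0" "x0 < b"
    and above: "\<And>x. a \<le> x \<Longrightarrow> x \<le> b \<Longrightarrow> s x \<le> \<alpha> + \<beta> * k x - \<epsilon> * (k x)\<^sup>2"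
    and touch: "s x0 = \<alpha> + \<beta> * k x0 - \<epsilon> * (k x0)\<^sup>2"
  shows False
proof -
  obtain e where e: "e > 0" "ball x0 e \<subseteq> interior I"
    using x0 open_interior open_contains_ball by blast
  define a' b' where "a' = max a (x0 - e)" and "b' = min b (x0 + e)"
  have ab': "a' < x0" "x0 < b'"
    using e assms(10,11) by (auto simp: a'_def b'_def)
  have int: "x \<in> interior I" if "a' < x" "x < b'" for x
    using that e(2) by (auto simp: a'_def b'_def dist_real_def subset_iff)
  have int_I: "x \<in> I" if "a' < x" "x < b'" for x
    using int[OF that] interior_subset by blast
  define T where "T = (\<lambda>x. \<alpha> + \<beta> * k x - \<epsilon> * (k x)\<^sup>2)"
  define T' where "T' = (\<lambda>x. (\<beta> - 2 * \<epsilon> * k x) * D I k x)"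
  define T2 where "T2 = (\<beta> - 2 * \<epsilon> * k x0) * D I (D I k) x0 - 2 * \<epsilon> * (D I k x0)\<^sup>2"
  note dk = SM_derivatives_interior[OF k]
  note dc = SM_derivatives_interior[OF c]
  have dT: "(T has_real_derivative T' x) (at x)" if "x \<in> interior I" for x
    unfolding T_def T'_def
    by (rule derivative_eq_intros dk(1)[OF that] refl | simp add: algebra_simps)+
  have dT': "(T' has_real_derivative T2) (at x0)"
    unfolding T2_def T'_def
    by (rule derivative_eq_intros dk(1)[OF x0] dk(2)[OF x0] refl
        | simp add: algebra_simps power2_eq_square)+
  \<comment> \<open>\<open>T\<close> lies above the increasing \<open>s\<close> to the right of their contact point. The sign matters
      when the inequality between the ratios is strict.\<close>
  have "T' x0 \<ge> 0"
  proof (rule ccontr)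
    assume "\<not> T' x0 \<ge> 0"
    then obtain d where d: "d > 0" "\<And>h. 0 < h \<Longrightarrow> h < d \<Longrightarrow> T (x0 + h) < T x0"
      using DERIV_neg_dec_right[OF dT[OF x0]] by (metis not_le)
    define x where "x = x0 + min d (b' - x0) / 2"
    have x: "x0 < x" "x < b'" "x - x0 < d"
      using d ab' by (auto simp: x_def min_def field_simps)
    have "T x < T x0"
      using d(2)[of "x - x0"] x by auto
    moreover have "s x \<le> T x"
      using above[of x] x ab' by (auto simp: T_def a'_def b'_def)
    moreover have "s x0 < s x"
      using s(2) int_I[of x0] int_I[of x] x ab' by (meson less_trans strict_mono_onD)
    ultimately show False
      using touch by (simp add: T_def)
  qed
  \<comment> \<open>This multiplier makes \<open>T - l c\<close> stationary at \<open>x0\<close>.\<close>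
  define l where "l = T' x0 / D I c x0"
  have neg: "T2 - l * D I (D I c) x0 < 0"
  proof -
    have "T2 - l * D I (D I c) x0
        = T' x0 * (D I (D I k) x0 / D I k x0 - D I (D I c) x0 / D I c x0) - 2 * \<epsilon> * (D I k x0)\<^sup>2"
      using dk(3)[OF x0] dc(3)[OF x0]
      by (simp add: T2_def T'_def l_def field_simps)
    moreover have "T' x0 * (D I (D I k) x0 / D I k x0 - D I (D I c) x0 / D I c x0) \<le> 0"
      using \<open>T' x0 \<ge> 0\<close> ratio by (simp add: mult_nonneg_nonpos)
    moreover have "2 * \<epsilon> * (D I k x0)\<^sup>2 > 0"
      using \<open>\<epsilon> > 0\<close> dk(3)[OF x0] by simp
    ultimately show ?thesis by linarith
  qed
  obtain d where d: "d > 0"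
    "\<And>x. x \<noteq> x0 \<Longrightarrow> \<bar>x - x0\<bar> < d \<Longrightarrow> T x - l * c x < T x0 - l * c x0"
  proof (rule strict_local_max_second_derivative[OF ab', of "\<lambda>x. T x - l * c x"
        "\<lambda>x. T' x - l * D I c x"])
    show "((\<lambda>x. T x - l * c x) has_real_derivative T' x - l * D I c x) (at x)"
      if "a' < x" "x < b'" for x
      using dT[OF int] dc(1)[OF int] that by (auto intro!: derivative_eq_intros)
    show "((\<lambda>x. T' x - l * D I c x) has_real_derivative T2 - l * D I (D I c) x0) (at x0)"
      using dT' dc(2)[OF x0] by (auto intro!: derivative_eq_intros)
    show "T' x0 - l * D I c x0 = 0"
      using dc(3)[OF x0] by (simp add: l_def)
  qed (use neg in auto)
  define d' where "d' = Min {d, x0 - a', b' - x0}"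
  have d': "d' > 0" "d' \<le> d" "d' \<le> x0 - a'" "d' \<le> b' - x0"
    using d ab' by (auto simp: d'_def)
  obtain x where x: "x \<noteq> x0" "\<bar>x - x0\<bar> < d'" "s x - l * c x \<ge> s x0 - l * c x0"
    using no_strict_local_max[OF I c s le x0 d'(1)] by blast
  have "s x \<le> T x"
    using above[of x] x d' by (auto simp: T_def a'_def b'_def)
  moreover have "T x - l * c x < T x0 - l * c x0"
    using d(2) x d' by auto
  ultimately show False
    using x(3) touch by (simp add: T_def)
qed

text \<open>
  Convexity in the viscosity sense implies convexity. The contact point is found as a maximum over
  the segment between the endpoints of a violated chord; it is interior since the comparison
  function agrees with \<open>s\<close> at both ends and is below \<open>s\<close> somewhere between.
\<close>

lemma convex_through_generator:
  fixes k s :: "real \<Rightarrow> real"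
  assumes I: "is_interval I" and k: "continuous_on I k" "inj_on k I" and s: "continuous_on I s"
    and no_touch: "\<And>a b x0 \<alpha> \<beta> \<epsilon>.
      \<lbrakk>\<epsilon> > 0; a < x0; x0 < b; {a..b} \<subseteq> I;
       \<And>x. a \<le> x \<Longrightarrow> x \<le> b \<Longrightarrow> s x \<le> \<alpha> + \<beta> * k x - \<epsilon> * (k x)\<^sup>2;
       s x0 = \<alpha> + \<beta> * k x0 - \<epsilon> * (k x0)\<^sup>2\<rbrakk> \<Longrightarrow> False"
  shows "convex_on (k ` I) (\<lambda>y. s (the_inv_into I k y))"
proof (rule convex_on_linorderI)
  show "convex (k ` I)"
    by (rule convex_image_of_interval[OF I k(1)])
  fix t y1 y2 :: real
  assume t: "0 < t" "t < 1" and y: "y1 \<in> k ` I" "y2 \<in> k ` I" "y1 < y2"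
  define ym where "ym = (1 - t) *\<^sub>R y1 + t *\<^sub>R y2"
  obtain x1 x2 where x12: "x1 \<in> I" "x2 \<in> I" "k x1 = y1" "k x2 = y2"
    using y by auto
  define a b where "a = min x1 x2" and "b = max x1 x2"
  have "x1 \<noteq> x2" using x12 y(3) by auto
  then have "a < b" by (auto simp: a_def b_def)
  have seg: "closed_segment x1 x2 = {a..b}"
    by (auto simp: closed_segment_eq_real_ivl a_def b_def)
  have ends: "{a, b} = {x1, x2}"
    by (auto simp: a_def b_def min_def max_def)
  have sub: "{a..b} \<subseteq> I"
    using I x12 ends by (metis closed_segment_subset is_interval_convex seg)
  have "ym - y1 = t * (y2 - y1)" "y2 - ym = (1 - t) * (y2 - y1)"
    by (auto simp: ym_def algebra_simps)
  then have ym: "y1 < ym" "ym < y2"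
    using t y(3) by (metis diff_gt_0_iff_gt mult_pos_pos)+
  have "ym \<in> closed_segment (k x1) (k x2)"
    using ym x12 by (auto simp: closed_segment_eq_real_ivl)
  then obtain xm where xm: "xm \<in> {a..b}" "k xm = ym"
    using IVT'_closed_segment_real[of ym k x1 x2] continuous_on_subset[OF k(1) sub] seg by auto
  have inv: "the_inv_into I k (k x) = x" if "x \<in> I" for x
    using the_inv_into_f_f[OF k(2) that] .
  have "s xm \<le> (1 - t) * s x1 + t * s x2"
  proof (rule ccontr)
    assume above_chord: "\<not> s xm \<le> (1 - t) * s x1 + t * s x2"
    define m where "m = (s x2 - s x1) / (y2 - y1)"
    define gap where "gap = s xm - (s x1 + m * (ym - y1))"
    have "s x1 + m * (ym - y1) = (1 - t) * s x1 + t * s x2"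
    proof -
      have "m * (ym - y1) = t * (m * (y2 - y1))"
        by (simp add: \<open>ym - y1 = t * (y2 - y1)\<close>)
      also have "m * (y2 - y1) = s x2 - s x1"
        using y(3) by (simp add: m_def)
      finally show ?thesis by (simp add: algebra_simps)
    qed
    then have "gap > 0"
      using above_chord by (simp add: gap_def)
    \<comment> \<open>So small that the parabola over the chord uses up only half of the gap at \<open>ym\<close>.\<close>
    define \<epsilon> where "\<epsilon> = gap / (2 * ((ym - y1) * (y2 - ym)))"
    have prod: "(ym - y1) * (y2 - ym) > 0" using ym by simp
    then have "\<epsilon> > 0" using \<open>gap > 0\<close> by (simp add: \<epsilon>_def)
    have \<epsilon>: "\<epsilon> * ((ym - y1) * (y2 - ym)) = gap / 2"
    proof -
      have "gap / (2 * P) * P = gap / 2" if "P > 0" for P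
        using that by simp
      then show ?thesis
        unfolding \<epsilon>_def using prod by blast
    qed
    define Q where "Q = (\<lambda>x. s x1 + m * (k x - y1) + \<epsilon> * ((k x - y1) * (y2 - k x)))"
    define w where "w = (\<lambda>x. s x - Q x)"
    have w_ends: "w x1 = 0" "w x2 = 0"
      using x12 y(3) by (auto simp: w_def Q_def m_def)
    have w_m: "w xm > 0"
      using \<epsilon> \<open>gap > 0\<close> by (simp add: w_def Q_def xm gap_def)
    have "continuous_on {a..b} w"
      unfolding w_def Q_def
      using continuous_on_subset[OF k(1) sub] continuous_on_subset[OF s sub]
      by (intro continuous_intros)
    then obtain x0 where x0: "x0 \<in> {a..b}" "\<And>x. x \<in> {a..b} \<Longrightarrow> w x \<le> w x0"
      using continuous_attains_sup[of "{a..b}" w] \<open>a < b\<close> by auto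
    have "w x0 > 0" using x0(2)[OF xm(1)] w_m by simp
    then have "x0 \<notin> {a, b}" using w_ends ends by auto
    then have ab: "a < x0" "x0 < b" using x0(1) by auto
    \<comment> \<open>Coefficients of the parabola \<open>Q\<close> raised by its largest deficit \<open>w x0\<close>.\<close>
    define \<alpha> where "\<alpha> = w x0 + s x1 - m * y1 - \<epsilon> * y1 * y2"
    define \<beta> where "\<beta> = m + \<epsilon> * (y1 + y2)"
    have quad: "w x0 + Q x = \<alpha> + \<beta> * k x - \<epsilon> * (k x)\<^sup>2" for x
      by (simp add: Q_def \<alpha>_def \<beta>_def algebra_simps power2_eq_square)
    show False
    proof (rule no_touch[OF \<open>\<epsilon> > 0\<close> ab sub])
      show "s x \<le> \<alpha> + \<beta> * k x - \<epsilon> * (k x)\<^sup>2" if "a \<le> x" "x \<le> b" for x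
        using x0(2)[of x] that quad[of x] by (simp add: w_def)
      show "s x0 = \<alpha> + \<beta> * k x0 - \<epsilon> * (k x0)\<^sup>2"
        using quad[of x0] by (simp add: w_def)
    qed
  qed
  moreover have "xm \<in> I" using xm(1) sub by auto
  ultimately show "s (the_inv_into I k ((1 - t) *\<^sub>R y1 + t *\<^sub>R y2))
      \<le> (1 - t) * s (the_inv_into I k y1) + t * s (the_inv_into I k y2)"
    using inv[OF x12(1)] inv[OF x12(2)] inv[of xm] x12 xm(2) by (simp add: ym_def)
qed

text \<open>Jensen's inequality, translated into means by inverting the increasing function \<open>s\<close>.\<close>

lemma qa_le_if_convex_through_generator:
  assumes I: "is_interval I" and k: "continuous_on I k" "inj_on k I"
    and s: "s \<in> CM I" "strict_mono_on I s"
    and conv: "convex_on (k ` I) (\<lambda>y. s (the_inv_into I k y))"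
  shows "qa_le I k s"
  unfolding qa_le_def
proof
  fix v assume v: "v \<in> vectors I"
  then have v': "v \<noteq> []" "set v \<subseteq> I" by (auto simp: vectors_def)
  let ?n = "length v"
  have nth: "v ! i \<in> I" if "i < ?n" for i
    using that v' nth_mem by blast
  have "s (qa_mean I k v)
      = s (the_inv_into I k (\<Sum>i<?n. (1 / real ?n) *\<^sub>R k (v ! i)))"
    unfolding qa_mean_def mean_eq_weighted_sum ..
  also have "\<dots> \<le> (\<Sum>i<?n. (1 / real ?n) * s (the_inv_into I k (k (v ! i))))"
    by (rule convex_on_sum[OF _ _ conv]) (use v' nth in auto)
  also have "\<dots> = (\<Sum>i<?n. (1 / real ?n) *\<^sub>R s (v ! i))"
    using nth the_inv_into_f_f[OF k(2)] by simp
  also have "\<dots> = s (qa_mean I s v)"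
    unfolding generator_qa_mean[OF I CM_continuous[OF s(1)] CM_inj_on[OF s(1)] v]
      mean_eq_weighted_sum ..
  finally have "s (qa_mean I k v) \<le> s (qa_mean I s v)" .
  then show "qa_mean I k v \<le> qa_mean I s v"
    using strict_mono_onD[OF s(2)] qa_mean_in_interval[OF I k v]
      qa_mean_in_interval[OF I CM_continuous[OF s(1)] CM_inj_on[OF s(1)] v]
    by (meson not_le)
qed

lemma qa_le_if_curvature_dominated_increasing:
  assumes I: "is_interval I" and k: "k \<in> SM I"
    and s: "s \<in> CM I" "strict_mono_on I s"
    and dom: "\<And>x. x \<in> interior I \<Longrightarrow>
      \<exists>c\<in>SM I. qa_le I c s \<and> D I (D I k) x / D I k x \<le> D I (D I c) x / D I c x"
  shows "qa_le I k s"
proof (rule qa_le_if_convex_through_generator[OF I SM_continuous[OF k] SM_inj_on[OF I k] s],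
       rule convex_through_generator[OF I SM_continuous[OF k] SM_inj_on[OF I k]
         CM_continuous[OF s(1)]])
  fix a b x0 \<alpha> \<beta> \<epsilon> :: real
  assume *: "\<epsilon> > 0" "a < x0" "x0 < b" "{a..b} \<subseteq> I"
    "\<And>x. a \<le> x \<Longrightarrow> x \<le> b \<Longrightarrow> s x \<le> \<alpha> + \<beta> * k x - \<epsilon> * (k x)\<^sup>2"
    "s x0 = \<alpha> + \<beta> * k x0 - \<epsilon> * (k x0)\<^sup>2"
  have x0: "x0 \<in> interior I"
    using *(2-4) by (metis greaterThanLessThan_iff interior_atLeastAtMost_real interior_mono subsetD)
  obtain c where c: "c \<in> SM I" "qa_le I c s"
    "D I (D I k) x0 / D I k x0 \<le> D I (D I c) x0 / D I c x0"
    using dom[OF x0] by blast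
  show False
    by (rule no_touching_from_above[OF I k c(1) s c(2) x0 c(3) *(1-3) *(5,6)])
qed

text \<open>
  The comparison principle. The generator \<open>c\<close> may vary with the point, which lets \<open>f\<close> and \<open>g\<close>
  take turns in dominating the ratio of their maximum.
\<close>

lemma qa_le_if_curvature_dominated:
  assumes I: "is_interval I" and k: "k \<in> SM I" and s: "s \<in> CM I"
    and dom: "\<And>x. x \<in> interior I \<Longrightarrow>
      \<exists>c\<in>SM I. qa_le I c s \<and> D I (D I k) x / D I k x \<le> D I (D I c) x / D I c x"
  shows "qa_le I k s"
proof (cases "strict_mono_on I s")
  case True
  then show ?thesis
    using qa_le_if_curvature_dominated_increasing[OF I k s _ dom] by blast
next
  case False
  let ?s = "\<lambda>x. - s x"
  have mono: "strict_mono_on I ?s"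
    using False s by (auto simp: CM_def monotone_on_def)
  then have "?s \<in> CM I"
    using CM_continuous[OF s] by (simp add: CM_def continuous_on_minus)
  moreover have neg: "qa_le I c ?s = qa_le I c s" for c
    by (simp add: qa_le_def qa_mean_uminus)
  ultimately have "qa_le I k ?s"
    using qa_le_if_curvature_dominated_increasing[OF I k _ mono] dom by simp
  then show ?thesis by (simp add: neg)
qed

section \<open>Prescribing the ratio of the derivatives\<close>

lemma nontrivial_interval_not_isolated:
  fixes I :: "real set"
  assumes "is_interval I" "a \<in> I" "b \<in> I" "a < b" "x \<in> I"
  shows "at x within I \<noteq> bot"
proof -
  have "x islimpt I"
    using assms by (metis connected_imp_perfect is_interval_connected_1 less_irrefl singleton_iff)
  then show ?thesis by (simp add: trivial_limit_within)
qed

text \<open>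
  The interval may be open, half-open or unbounded, so the fundamental theorem is applied on compact
  subintervals that contain the base point \<open>p\<close> and a relative neighbourhood of the given point.
\<close>

lemma antiderivative_on_interval:
  fixes M :: "real \<Rightarrow> real"
  assumes I: "is_interval I" and M: "continuous_on I M"
  obtains N where "\<And>x. x \<in> I \<Longrightarrow> (N has_real_derivative M x) (at x within I)"
proof (cases "I = {}")
  case False
  then obtain p where p: "p \<in> I" by auto
  \<comment> \<open>The oriented integral from \<open>p\<close> to \<open>x\<close>: integrals over empty intervals vanish.\<close>
  define N where "N = (\<lambda>x. integral {p..x} M - integral {x..p} M)"
  have "(N has_real_derivative M x) (at x within I)" if x: "x \<in> I" for x
  proof -
    obtain c where c: "c \<in> I" "c \<le> p" "c \<le> x" "c < x \<or> (\<forall>y\<in>I. x \<le> y)"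
    proof (cases "\<exists>y\<in>I. y < x")
      case True
      then obtain y where "y \<in> I" "y < x" by blast
      then show thesis using p by (intro that[of "min p y"]) (auto simp: min_def)
    next
      case False
      then show thesis using p x by (intro that[of x]) (auto simp: not_less)
    qed
    obtain d where d: "d \<in> I" "p \<le> d" "x \<le> d" "x < d \<or> (\<forall>y\<in>I. y \<le> x)"
    proof (cases "\<exists>y\<in>I. x < y")
      case True
      then obtain y where "y \<in> I" "x < y" by blast
      then show thesis using p by (intro that[of "max p y"]) (auto simp: max_def)
    next
      case False
      then show thesis using p x by (intro that[of x]) (auto simp: not_less)
    qed
    have sub: "{c..d} \<subseteq> I"
      using c d I by (meson atLeastAtMost_iff mem_is_interval_1_I subsetI)
    have Mcd: "continuous_on {c..d} M"
      using continuous_on_subset[OF M sub] .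
    have N: "integral {c..y} M - integral {c..p} M = N y" if y: "y \<in> {c..d}" for y
    proof -
      have int: "M integrable_on {c..z}" if "z \<in> {c..d}" for z
        using continuous_on_subset[OF Mcd, of "{c..z}"] that
        by (intro integrable_continuous_real) auto
      show ?thesis
      proof (cases "p \<le> y")
        case True
        then show ?thesis
          using Henstock_Kurzweil_Integration.integral_combine[OF c(2) True int[OF y]]
          by (cases "p = y") (auto simp: N_def)
      next
        case False
        then have "y \<le> p" "p \<in> {c..d}" "c \<le> y" using c d y by auto
        then show ?thesis
          using Henstock_Kurzweil_Integration.integral_combine[OF \<open>c \<le> y\<close> \<open>y \<le> p\<close> int]
            False by (auto simp: N_def)
      qed
    qed
    have xcd: "x \<in> {c..d}" using c d by auto
    have "((\<lambda>y. integral {c..y} M - integral {c..p} M) has_real_derivative M x) (at x within {c..d})"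
      using DERIV_diff[OF integral_has_real_derivative[OF Mcd xcd] DERIV_const] by simp
    then have "(N has_real_derivative M x) (at x within {c..d})"
      by (rule has_field_derivative_transform_within[OF _ zero_less_one xcd]) (use N in auto)
    moreover have "at x within I = at x within {c..d}"
    proof (rule at_within_nhd)
      \<comment> \<open>An endpoint of \<open>{c..d}\<close> that equals \<open>x\<close> is also an endpoint of \<open>I\<close>, so the
          neighbourhood may extend beyond it.\<close>
      let ?S = "{(if c < x then c else x - 1)<..<(if x < d then d else x + 1)}"
      show "x \<in> ?S" "open ?S" by auto
      show "I \<inter> ?S - {x} = {c..d} \<inter> ?S - {x}"
        using c d sub by (auto split: if_splits) force+
    qed
    ultimately show ?thesis by simp
  qed
  with that show thesis by blast
qed (use that in auto)

lemma D_eqI: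
  assumes "at x within I \<noteq> bot" "(f has_real_derivative y) (at x within I)"
  shows "D I f x = y"
  using assms unfolding D_def
  by (simp add: has_real_derivative_iff_has_vector_derivative vector_derivative_within)

text \<open>
  Since \<open>h'' / h'\<close> is the logarithmic derivative of \<open>h'\<close>, take for \<open>h'\<close> the exponential of an
  antiderivative of \<open>M\<close>.
\<close>

lemma increasing_generator_with_ratio:
  assumes I: "is_interval I" "a \<in> I" "b \<in> I" "a < b" and M: "continuous_on I M"
  obtains h where "h \<in> SM I" "h \<in> CM I" "\<And>x. x \<in> I \<Longrightarrow> D I (D I h) x / D I h x = M x"
proof -
  obtain N where N: "\<And>x. x \<in> I \<Longrightarrow> (N has_real_derivative M x) (at x within I)"
    using antiderivative_on_interval[OF I(1) M] by blast
  have eN: "((\<lambda>x. exp (N x)) has_real_derivative exp (N x) * M x) (at x within I)" if "x \<in> I" for x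
    using N[OF that] by (auto intro!: derivative_eq_intros)
  obtain h where h: "\<And>x. x \<in> I \<Longrightarrow> (h has_real_derivative exp (N x)) (at x within I)"
    using antiderivative_on_interval[OF I(1) DERIV_continuous_on[OF eN]] by blast
  note nb = nontrivial_interval_not_isolated[OF I]
  have Dh: "D I h x = exp (N x)" if "x \<in> I" for x
    using D_eqI[OF nb h] that by blast
  have dDh: "(D I h has_real_derivative exp (N x) * M x) (at x within I)" if "x \<in> I" for x
    by (rule has_field_derivative_transform_within[OF eN[OF that] zero_less_one that])
       (simp add: Dh)
  have DDh: "D I (D I h) x = exp (N x) * M x" if "x \<in> I" for x
    using D_eqI[OF nb dDh] that by blast
  have "continuous_on I (\<lambda>x. exp (N x) * M x)"
    using M DERIV_continuous_on[OF N] by (intro continuous_intros) auto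
  then have "continuous_on I (D I (D I h))"
    by (simp add: DDh cong: continuous_on_cong)
  then have "h \<in> SM I"
    unfolding SM_def C2_on_def differentiable_on_def
    using h dDh by (auto simp: Dh real_differentiable_def)
  moreover have "strict_mono_on I h"
  proof (rule strict_mono_onI)
    fix x y assume xy: "x \<in> I" "y \<in> I" "x < y"
    have sub: "{x..y} \<subseteq> I"
      using xy I(1) by (meson atLeastAtMost_iff mem_is_interval_1_I subsetI)
    show "h x < h y"
    proof (rule DERIV_pos_imp_increasing_open[OF xy(3)])
      show "continuous_on {x..y} h"
        using continuous_on_subset[OF DERIV_continuous_on[OF h] sub] .
      fix z assume "x < z" "z < y"
      then have "z \<in> interior I"
        using sub by (metis greaterThanLessThan_iff interior_atLeastAtMost_real interior_mono subsetD)
      then show "\<exists>l. (h has_real_derivative l) (at z) \<and> 0 < l"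
        using h[of z] interior_subset[of I] by (metis at_within_interior exp_gt_zero subsetD)
    qed
  qed
  then have "h \<in> CM I"
    using DERIV_continuous_on[OF h] by (simp add: CM_def)
  ultimately show thesis
    using that Dh DDh by simp
qed

section \<open>The least upper bound of two means\<close>

lemma upper_mean_eq_least_upper_bound:
  assumes "h \<in> upper I f \<inter> upper I g" "\<And>s. s \<in> upper I f \<inter> upper I g \<Longrightarrow> qa_le I h s"
    and "v \<in> vectors I"
  shows "upper_mean I f g v = qa_mean I h v"
proof -
  have "(INF s\<in>upper I f \<inter> upper I g. qa_mean I s v) = qa_mean I h v"
    by (rule cInf_eq_minimum) (use assms in \<open>auto simp: qa_le_def\<close>)
  then show ?thesis
    using assms(1) by (auto simp: upper_mean_def)
qed

text \<open>
  On a one-point domain every number is a derivative of every function, and the derivative is the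
  same arbitrary choice for all functions. So all ratios agree, as do all means.
\<close>

lemma D_singleton: "D {a} f a = D {a} g a"
  by (simp add: D_def vector_derivative_def has_vector_derivative_def has_derivative_def
      at_within_def bounded_linear_scaleR_left)

lemma qa_le_singleton:
  assumes "f \<in> CM {a}" "g \<in> CM {a}"
  shows "qa_le {a} f g"
  using qa_mean_in_interval[of "{a}"] is_interval_cc[of a a] assms CM_continuous CM_inj_on
  unfolding qa_le_def by (metis atLeastAtMost_singleton order_refl singletonD)

theorem lemma2p1:
  fixes I :: "real set" and f g :: "real \<Rightarrow> real"
  assumes "is_interval I" and "f \<in> SM I" and "g \<in> SM I"
  shows "\<exists>h\<in>SM I.
           (\<forall>v\<in>vectors I. upper_mean I f g v = qa_mean I h v) \<and>
           (\<forall>x\<in>I. D I (D I h) x / D I h x =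
                  max (D I (D I f) x / D I f x) (D I (D I g) x / D I g x))"
proof -
  consider (nontrivial) a b where "a \<in> I" "b \<in> I" "a < b" | (singleton) a where "I = {a}"
    | (empty) "I = {}"
  proof (cases "\<exists>a\<in>I. \<exists>b\<in>I. a < b")
    case True
    then show thesis using nontrivial by blast
  next
    case False
    then have "x = y" if "x \<in> I" "y \<in> I" for x y
      using that by (meson linorder_neqE)
    then show thesis using singleton empty by blast
  qed
  then show ?thesis
  proof cases
    case nontrivial
    let ?r = "\<lambda>k x. D I (D I k) x / D I k x"
    have cont: "continuous_on I (?r k)" if "k \<in> SM I" for k
      using that SM_derivatives(2,3)[OF that]
      by (intro continuous_on_divide) (auto simp: SM_def C2_on_def intro: DERIV_continuous_on)
    have "continuous_on I (\<lambda>x. max (?r f x) (?r g x))"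
      by (intro continuous_on_max cont assms)
    then obtain h where h: "h \<in> SM I" "h \<in> CM I" "\<And>x. x \<in> I \<Longrightarrow> ?r h x = max (?r f x) (?r g x)"
      using increasing_generator_with_ratio[OF assms(1) nontrivial] by blast
    have h_int: "?r h x = max (?r f x) (?r g x)" if "x \<in> interior I" for x
      using h(3) that interior_subset by blast
    have "qa_le I h h" by (simp add: qa_le_def)
    have "qa_le I k h" if "k \<in> {f, g}" for k
    proof (rule qa_le_if_curvature_dominated[OF assms(1) _ h(2)])
      show "k \<in> SM I" using that assms by auto
      show "\<exists>c\<in>SM I. qa_le I c h \<and> ?r k x \<le> ?r c x" if "x \<in> interior I" for x
        using h(1) \<open>qa_le I h h\<close> h_int[OF that] \<open>k \<in> {f, g}\<close> by (intro bexI[of _ h]) auto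
    qed
    then have upper: "h \<in> upper I f \<inter> upper I g"
      using h(2) by (simp add: upper_def)
    have least: "qa_le I h s" if s: "s \<in> upper I f \<inter> upper I g" for s
    proof (rule qa_le_if_curvature_dominated[OF assms(1) h(1)])
      show "s \<in> CM I" using s by (simp add: upper_def)
      show "\<exists>c\<in>SM I. qa_le I c s \<and> ?r h x \<le> ?r c x" if "x \<in> interior I" for x
      proof (cases "?r g x \<le> ?r f x")
        case True
        then show ?thesis
          using s assms(2) h_int[OF that] by (intro bexI[of _ f]) (auto simp: upper_def)
      next
        case False
        then show ?thesis
          using s assms(3) h_int[OF that] by (intro bexI[of _ g]) (auto simp: upper_def)
      qed
    qed
    show ?thesis
      using h(1,3) upper_mean_eq_least_upper_bound[OF upper least] by blast
  next
    case (singleton a)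
    have "f \<in> CM I" "g \<in> CM I"
      by (auto simp: singleton CM_def monotone_on_def)
    then have "upper_mean I f g v = qa_mean I f v" if "v \<in> vectors I" for v
      using that unfolding singleton
      by (intro upper_mean_eq_least_upper_bound) (auto simp: upper_def qa_le_singleton)
    moreover have "D I (D I f) a / D I f a = D I (D I g) a / D I g a"
      unfolding singleton using D_singleton by metis
    ultimately show ?thesis
      using assms(2) singleton by auto
  next
    case empty
    then show ?thesis
      using assms(2) by (auto simp: vectors_def)
  qed
qed

end
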